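(* Let $G$ be a finite group with commutator subgroup $G'$, and let $\mathcal C=\mathcal C(\mathcal B(G),\mathcal F(G))$ be the class semigroup of $\mathcal B(G)$ in $\mathcal F(G)$. The following statements are equivalent: (a) $|G'|\le 2$. (b) $\mathcal B(G)$ is a seminormal monoid. (c) $\mathcal C$ is a Clifford semigroup. If this is the case, then $\mathcal B(G)=\{S\in\mathcal F(G)\mid [S]\in\mathsf E(\mathcal C)\}$.
   Context: Let $G$ be a finite group with identity $1_G$. $\mathcal F(G)$ is the free abelian monoid with basis $G$, its operation written $\cdot$ ; its elements are called sequences over $G$ (finite, unordered, repetition allowed), and its identity is the empty sequence $1_{\mathcal F(G)}$. For $S=g_1\cdot\ldots\cdot g_\ell$, $\pi(S)=\{g_{\tau(1)}\cdots g_{\tau(\ell)}\in G \mid \tau \text{ a permutation of } [1,\ell]\}$, with $\pi(1_{\mathcal F(G)})=\{1_G\}$. The monoid of product-one sequences is $\mathcal B(G)=\{S\in\mathcal F(G)\mid 1_G\in\pi(S)\}$. For $S,S'\in\mathcal F(G)$ write $S\sim S'$ if for all $T\in\mathcal F(G)$: $S\cdot T\in\mathcal B(G)\Leftrightarrow S'\cdot T\in\mathcal B(G)$. This is a congruence; $[S]$ is the class of $S$, and $\mathcal C(\mathcal B(G),\mathcal F(G))=\{[S]\mid S\in\mathcal F(G)\}$, with $[S]+[S']=[S\cdot S']$, is the class semigroup (a finite commutative semigroup with identity $[1_{\mathcal F(G)}]$). $\mathsf E(\mathcal C)$ is the set of idempotents of $\mathcal C$. $\mathcal C$ is a Clifford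 semigroup if every element lies in a subgroup of $\mathcal C$ (a subsemigroup that is a group, possibly with a different identity element). A (commutative, cancellative) monoid $H$ with quotient group $\mathsf q(H)$ is seminormal if $x\in\mathsf q(H)$ and $x^2,x^3\in H$ imply $x\in H$. *)

theory Defs
  imports "HOL-Algebra.Divisibility" "HOL-Algebra.Generated_Groups" "HOL-Library.Multiset"
begin

section \<open>Sequences and product-one sequences\<close>

definition free_comm_monoid :: "'a set \<Rightarrow> 'a multiset monoid"
  where "free_comm_monoid A = \<lparr>carrier = {S. set_mset S \<subseteq> A}, monoid.mult = (+), one = {#}\<rparr>"

text \<open>The lists \<open>xs\<close> with \<open>mset xs = S\<close> are exactly the orderings of the unordered sequence \<open>S\<close>.\<close>

definition products :: "('a, 'b) monoid_scheme \<Rightarrow> 'a multiset \<Rightarrow> 'a set"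
  where "products G S = {foldr (\<otimes>\<^bsub>G\<^esub>) xs \<one>\<^bsub>G\<^esub> | xs. mset xs = S}"

definition product_one_seqs :: "('a, 'b) monoid_scheme \<Rightarrow> 'a multiset set"
  where "product_one_seqs G =
    {S \<in> carrier (free_comm_monoid (carrier G)). \<one>\<^bsub>G\<^esub> \<in> products G S}"

definition product_one_monoid :: "('a, 'b) monoid_scheme \<Rightarrow> 'a multiset monoid"
  where "product_one_monoid G = (free_comm_monoid (carrier G))\<lparr>carrier := product_one_seqs G\<rparr>"


section \<open>Class semigroups\<close>

definition class_rel :: "'a set \<Rightarrow> ('a, 'b) monoid_scheme \<Rightarrow> ('a \<times> 'a) set"
  where "class_rel H F = {(x, y) \<in> carrier F \<times> carrier F.
    \<forall>z \<in> carrier F. x \<otimes>\<^bsub>F\<^esub> z \<in> H \<longleftrightarrow> y \<otimes>\<^bsub>F\<^esub> z \<in> H}"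

definition cong_class :: "'a set \<Rightarrow> ('a, 'b) monoid_scheme \<Rightarrow> 'a \<Rightarrow> 'a set"
  where "cong_class H F x = class_rel H F `` {x}"

text \<open>
  The operation is written multiplicatively. The union in it runs over equal sets, by
  the lemma \<open>class_semigroup_mult\<close> below.
\<close>

definition class_semigroup :: "'a set \<Rightarrow> ('a, 'b) monoid_scheme \<Rightarrow> 'a set monoid"
  where "class_semigroup H F =
    \<lparr>carrier = cong_class H F ` carrier F,
     monoid.mult = (\<lambda>X Y. \<Union>x \<in> X. \<Union>y \<in> Y. cong_class H F (x \<otimes>\<^bsub>F\<^esub> y)),
     one = cong_class H F \<one>\<^bsub>F\<^esub>\<rparr>"

definition idempotents :: "('a, 'b) monoid_scheme \<Rightarrow> 'a set"
  where "idempotents C = {x \<in> carrier C. x \<otimes>\<^bsub>C\<^esub> x = x}"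

text \<open>The identity \<open>e\<close> of the subgroup need not be the identity of \<open>C\<close>.\<close>

definition clifford_semigroup :: "('a, 'b) monoid_scheme \<Rightarrow> bool"
  where "clifford_semigroup C \<longleftrightarrow>
    (\<forall>x \<in> carrier C. \<exists>K e. x \<in> K \<and> K \<subseteq> carrier C \<and> group (C\<lparr>carrier := K, one := e\<rparr>))"

context comm_monoid
begin

lemma equiv_class_rel: "equiv (carrier G) (class_rel H G)"
  by (rule equivI) (auto simp: class_rel_def refl_on_def sym_def trans_def)

lemma class_rel_mult:
  assumes "(x, x') \<in> class_rel H G" "(y, y') \<in> class_rel H G"
  shows "(x \<otimes> y, x' \<otimes> y') \<in> class_rel H G"
proof -
  have c: "x \<in> carrier G" "x' \<in> carrier G" "y \<in> carrier G" "y' \<in> carrier G"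
    using assms by (auto simp: class_rel_def)
  have "x \<otimes> y \<otimes> z \<in> H \<longleftrightarrow> x' \<otimes> y' \<otimes> z \<in> H" if z: "z \<in> carrier G" for z
  proof -
    have "x \<otimes> y \<otimes> z \<in> H \<longleftrightarrow> x \<otimes> (y \<otimes> z) \<in> H" using c z by (simp add: m_assoc)
    also have "\<dots> \<longleftrightarrow> x' \<otimes> (y \<otimes> z) \<in> H" using assms(1) c z by (simp add: class_rel_def)
    also have "\<dots> \<longleftrightarrow> y \<otimes> (x' \<otimes> z) \<in> H" using c z by (simp add: m_lcomm)
    also have "\<dots> \<longleftrightarrow> y' \<otimes> (x' \<otimes> z) \<in> H" using assms(2) c z by (simp add: class_rel_def)
    also have "\<dots> \<longleftrightarrow> x' \<otimes> y' \<otimes> z \<in> H" using c z by (simp add: m_ac)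
    finally show ?thesis .
  qed
  then show ?thesis using c by (simp add: class_rel_def)
qed

lemma class_semigroup_mult:
  assumes "x \<in> carrier G" "y \<in> carrier G"
  shows "cong_class H G x \<otimes>\<^bsub>class_semigroup H G\<^esub> cong_class H G y = cong_class H G (x \<otimes> y)"
proof -
  have eq: "cong_class H G (x' \<otimes> y') = cong_class H G (x \<otimes> y)"
    if "x' \<in> cong_class H G x" "y' \<in> cong_class H G y" for x' y'
    using that class_rel_mult equiv_class_eq[OF equiv_class_rel]
    unfolding cong_class_def by blast
  have ne: "cong_class H G x \<noteq> {}" "cong_class H G y \<noteq> {}"
    using assms equiv_class_self[OF equiv_class_rel] unfolding cong_class_def by blast+
  have "cong_class H G x \<otimes>\<^bsub>class_semigroup H G\<^esub> cong_class H G y =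
      (\<Union>x' \<in> cong_class H G x. \<Union>y' \<in> cong_class H G y. cong_class H G (x' \<otimes> y'))"
    by (simp add: class_semigroup_def)
  also have "\<dots> = (\<Union>x' \<in> cong_class H G x. \<Union>y' \<in> cong_class H G y. cong_class H G (x \<otimes> y))"
    by (intro SUP_cong refl eq)
  also have "\<dots> = cong_class H G (x \<otimes> y)"
    using ne by simp
  finally show ?thesis .
qed

lemma comm_monoid_class_semigroup: "comm_monoid (class_semigroup H G)"
proof -
  have car: "carrier (class_semigroup H G) = cong_class H G ` carrier G"
    and one: "\<one>\<^bsub>class_semigroup H G\<^esub> = cong_class H G \<one>"
    by (simp_all add: class_semigroup_def)
  show ?thesis
    by (rule comm_monoidI) (auto simp: car one class_semigroup_mult m_ac)
qed

end


section \<open>Quotient groups of monoids and seminormality\<close>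

text \<open>The pair \<open>(a, b)\<close> represents the fraction \<open>a / b\<close>.\<close>

definition fraction_rel :: "('a, 'b) monoid_scheme \<Rightarrow> (('a \<times> 'a) \<times> ('a \<times> 'a)) set"
  where "fraction_rel H = {((a, b), (c, d)).
    a \<in> carrier H \<and> b \<in> carrier H \<and> c \<in> carrier H \<and> d \<in> carrier H \<and>
    a \<otimes>\<^bsub>H\<^esub> d = c \<otimes>\<^bsub>H\<^esub> b}"

definition fraction :: "('a, 'b) monoid_scheme \<Rightarrow> 'a \<Rightarrow> 'a \<Rightarrow> ('a \<times> 'a) set"
  where "fraction H a b = fraction_rel H `` {(a, b)}"

definition quotient_group :: "('a, 'b) monoid_scheme \<Rightarrow> ('a \<times> 'a) set monoid"
  where "quotient_group H =
    \<lparr>carrier = {fraction H a b | a b. a \<in> carrier H \<and> b \<in> carrier H},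
     monoid.mult = (\<lambda>X Y. \<Union>(a, b) \<in> X. \<Union>(c, d) \<in> Y. fraction H (a \<otimes>\<^bsub>H\<^esub> c) (b \<otimes>\<^bsub>H\<^esub> d)),
     one = fraction H \<one>\<^bsub>H\<^esub> \<one>\<^bsub>H\<^esub>\<rparr>"

definition quotient_embed :: "('a, 'b) monoid_scheme \<Rightarrow> 'a \<Rightarrow> ('a \<times> 'a) set"
  where "quotient_embed H a = fraction H a \<one>\<^bsub>H\<^esub>"

definition seminormal_monoid :: "('a, 'b) monoid_scheme \<Rightarrow> bool"
  where "seminormal_monoid H \<longleftrightarrow> comm_monoid_cancel H \<and>
    (\<forall>x \<in> carrier (quotient_group H).
      x [^]\<^bsub>quotient_group H\<^esub> (2::nat) \<in> quotient_embed H ` carrier H \<longrightarrow>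
      x [^]\<^bsub>quotient_group H\<^esub> (3::nat) \<in> quotient_embed H ` carrier H \<longrightarrow>
      x \<in> quotient_embed H ` carrier H)"

context comm_monoid_cancel
begin

lemma equiv_fraction_rel: "equiv (carrier G \<times> carrier G) (fraction_rel G)"
proof (rule equivI)
  show "trans (fraction_rel G)"
  proof (rule transI, clarsimp simp: fraction_rel_def)
    fix a b c d e f
    assume c: "a \<in> carrier G" "b \<in> carrier G" "c \<in> carrier G" "d \<in> carrier G"
        "e \<in> carrier G" "f \<in> carrier G"
      and eq: "a \<otimes> d = c \<otimes> b" "c \<otimes> f = e \<otimes> d"
    have "a \<otimes> f \<otimes> d = (a \<otimes> d) \<otimes> f" using c by (simp add: m_ac)
    also have "\<dots> = (c \<otimes> f) \<otimes> b" unfolding eq(1) using c by (simp add: m_ac)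
    also have "\<dots> = e \<otimes> b \<otimes> d" unfolding eq(2) using c by (simp add: m_ac)
    finally show "a \<otimes> f = e \<otimes> b" using c by (meson m_closed r_cancel)
  qed
qed (auto simp: fraction_rel_def refl_on_def sym_def)

lemma fraction_eq_iff:
  assumes "a \<in> carrier G" "b \<in> carrier G" "c \<in> carrier G" "d \<in> carrier G"
  shows "fraction G a b = fraction G c d \<longleftrightarrow> a \<otimes> d = c \<otimes> b"
  using eq_equiv_class_iff[OF equiv_fraction_rel, of "(a, b)" "(c, d)"] assms
  by (simp add: fraction_def) (simp add: fraction_rel_def)

lemma quotient_group_mult:
  assumes "a \<in> carrier G" "b \<in> carrier G" "c \<in> carrier G" "d \<in> carrier G"
  shows "fraction G a b \<otimes>\<^bsub>quotient_group G\<^esub> fraction G c d = fraction G (a \<otimes> c) (b \<otimes> d)"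
proof -
  have eq: "fraction G (a' \<otimes> c') (b' \<otimes> d') = fraction G (a \<otimes> c) (b \<otimes> d)"
    if "(a', b') \<in> fraction G a b" "(c', d') \<in> fraction G c d" for a' b' c' d'
  proof -
    from that have c: "a' \<in> carrier G" "b' \<in> carrier G" "c' \<in> carrier G" "d' \<in> carrier G"
      and e: "a \<otimes> b' = a' \<otimes> b" "c \<otimes> d' = c' \<otimes> d"
      by (auto simp: fraction_def fraction_rel_def)
    have "(a' \<otimes> c') \<otimes> (b \<otimes> d) = (a' \<otimes> b) \<otimes> (c' \<otimes> d)" using assms c by (simp add: m_ac)
    also have "\<dots> = (a \<otimes> b') \<otimes> (c \<otimes> d')" by (simp add: e)
    also have "\<dots> = (a \<otimes> c) \<otimes> (b' \<otimes> d')" using assms c by (simp add: m_ac)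
    finally show ?thesis using assms c by (simp add: fraction_eq_iff)
  qed
  have ne: "fraction G a b \<noteq> {}" "fraction G c d \<noteq> {}"
    using assms by (auto simp: fraction_def fraction_rel_def)
  have "fraction G a b \<otimes>\<^bsub>quotient_group G\<^esub> fraction G c d =
      (\<Union>(a', b') \<in> fraction G a b. \<Union>(c', d') \<in> fraction G c d.
        fraction G (a' \<otimes> c') (b' \<otimes> d'))"
    by (simp add: quotient_group_def)
  also have "\<dots> = (\<Union>(a', b') \<in> fraction G a b. \<Union>(c', d') \<in> fraction G c d.
        fraction G (a \<otimes> c) (b \<otimes> d))"
    by (intro SUP_cong refl) (clarify, intro SUP_cong refl, clarify, rule eq)
  also have "\<dots> = fraction G (a \<otimes> c) (b \<otimes> d)"
    using ne by (simp add: case_prod_unfold)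
  finally show ?thesis .
qed

lemma comm_group_quotient_group: "comm_group (quotient_group G)"
proof -
  have car: "carrier (quotient_group G) = {fraction G a b | a b. a \<in> carrier G \<and> b \<in> carrier G}"
    and one: "\<one>\<^bsub>quotient_group G\<^esub> = fraction G \<one> \<one>"
    by (simp_all add: quotient_group_def)
  have inv: "\<exists>y \<in> carrier (quotient_group G). y \<otimes>\<^bsub>quotient_group G\<^esub> x = \<one>\<^bsub>quotient_group G\<^esub>"
    if x: "x \<in> carrier (quotient_group G)" for x
  proof -
    obtain a b where ab: "x = fraction G a b" "a \<in> carrier G" "b \<in> carrier G"
      using x car by auto
    have "fraction G b a \<otimes>\<^bsub>quotient_group G\<^esub> x = \<one>\<^bsub>quotient_group G\<^esub>"
      using ab by (simp add: one quotient_group_mult fraction_eq_iff m_comm)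
    then show ?thesis using ab car by blast
  qed
  have "x \<otimes>\<^bsub>quotient_group G\<^esub> y \<in> carrier (quotient_group G)"
    if "x \<in> carrier (quotient_group G)" "y \<in> carrier (quotient_group G)" for x y
    using that m_closed unfolding car by (fastforce simp: quotient_group_mult)
  moreover have "\<one>\<^bsub>quotient_group G\<^esub> \<in> carrier (quotient_group G)"
    using one car by blast
  ultimately show ?thesis
    by (intro comm_groupI inv) (auto simp: car one quotient_group_mult m_ac)
qed

lemma inj_on_quotient_embed: "inj_on (quotient_embed G) (carrier G)"
  by (rule inj_onI) (simp add: quotient_embed_def fraction_eq_iff)

end

end

theory Submission
  imports Defs "HOL-Algebra.Multiplicative_Group"
begin

text \<open>
  Put \<open>m = |G|\<close>. If \<open>|G'| \<le> 2\<close>, there is a central \<open>z\<close> with \<open>z\<^sup>2 = 1\<close> such that every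
  commutator is \<open>1\<close> or \<open>z\<close>, and exchanging two noncommuting terms of a sequence multiplies
  its product by \<open>z\<close>. Hence the class of \<open>S\<close> depends only on its support and on one of its
  products, so that \<open>S \<sim> S\<^bsup>m + 1\<^esup>\<close> for all \<open>S\<close>, and \<open>S \<sim> S\<^sup>2\<close> if \<open>S\<close> is a product-one sequence.

  If \<open>\<C>\<close> is a Clifford semigroup, then \<open>[S] = [S\<^sup>2 T]\<close> for some \<open>T\<close>, so \<open>S \<sim> S\<^bsup>m + 1\<^esup> T\<^sup>m\<close>. This
  is a product-one sequence whenever \<open>S\<^sup>2\<close> and \<open>S\<^sup>3\<close> are.

  If \<open>\<B>(G)\<close> is seminormal, then \<open>S\<^sup>m, S\<^bsup>m + 1\<^esup> \<in> \<B>(G)\<close> forces \<open>S \<in> \<B>(G)\<close>. Apply this to sequences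
  \<open>g\<^sub>1 \<cdot> \<dots> \<cdot> g\<^sub>k \<cdot> u\<^bsup>-1\<^esup>\<close> where \<open>u\<close> is the value of a group word with exponent sum \<open>1\<close> in each
  \<open>g\<^sub>i\<close>: as \<open>g\<^sup>m = 1\<close>, negative exponents can be made positive, so the hypothesis holds and
  \<open>u\<close> must be a product of the \<open>g\<^sub>i\<close> in some order. The word \<open>a\<^sup>2 b a\<^bsup>-1\<^esup>\<close> shows that squares
  are central, so commutators are central of order at most \<open>2\<close>; the word \<open>x y w [x, w]\<close>
  shows that all nontrivial commutators agree.
\<close>

section \<open>Products of lists\<close>

text \<open>This is the fold used in \<open>products\<close>, so the values \<open>lprod xs\<close>
  with \<open>mset xs = S\<close> are exactly the elements of \<open>products G S\<close>.\<close>

definition (in monoid) lprod :: "'a list \<Rightarrow> 'a"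
  where "lprod xs = foldr (\<otimes>) xs \<one>"

context monoid
begin

lemma lprod_Nil [simp]: "lprod [] = \<one>"
  and lprod_Cons [simp]: "lprod (x # xs) = x \<otimes> lprod xs"
  by (simp_all add: lprod_def)

lemma lprod_closed [simp]: "set xs \<subseteq> carrier G \<Longrightarrow> lprod xs \<in> carrier G"
  by (induction xs) auto

lemma lprod_append:
  "set xs \<subseteq> carrier G \<Longrightarrow> set ys \<subseteq> carrier G \<Longrightarrow> lprod (xs @ ys) = lprod xs \<otimes> lprod ys"
  by (induction xs) (auto simp: m_assoc)

lemma lprod_concat_replicate:
  "set xs \<subseteq> carrier G \<Longrightarrow> lprod (concat (replicate n xs)) = lprod xs [^] n"
proof (induction n)
  case (Suc n)
  have "set (concat (replicate n xs)) \<subseteq> carrier G" using Suc.prems by auto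
  then show ?case using Suc nat_pow_Suc2[of "lprod xs" n]
    by (simp add: lprod_append del: nat_pow_Suc)
qed simp

lemma lprod_replicate: "x \<in> carrier G \<Longrightarrow> lprod (replicate n x) = x [^] n"
  using nat_pow_Suc2 by (induction n) (auto simp del: nat_pow_Suc)

lemma lprod_commutes:
  assumes "x \<in> carrier G" "set ys \<subseteq> carrier G" "\<And>y. y \<in> set ys \<Longrightarrow> x \<otimes> y = y \<otimes> x"
  shows "x \<otimes> lprod ys = lprod ys \<otimes> x"
  using assms
proof (induction ys)
  case (Cons y ys)
  have c: "y \<in> carrier G" "lprod ys \<in> carrier G" using Cons.prems by auto
  have "x \<otimes> (y \<otimes> lprod ys) = y \<otimes> (x \<otimes> lprod ys)"
    using c Cons.prems(1,3) by (metis list.set_intros(1) m_assoc)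
  also have "\<dots> = y \<otimes> lprod ys \<otimes> x" using Cons c by (simp add: m_assoc)
  finally show ?case by simp
qed simp

text \<open>The first term of \<open>xs\<close> is located inside \<open>ys\<close> and moved to the
  front past a block with which it commutes.\<close>

lemma lprod_mset_cong:
  assumes "mset xs = mset ys" "set xs \<subseteq> carrier G"
    and "\<And>x y. x \<in> set xs \<Longrightarrow> y \<in> set xs \<Longrightarrow> x \<otimes> y = y \<otimes> x"
  shows "lprod ys = lprod xs"
  using assms
proof (induction xs arbitrary: ys)
  case (Cons x xs)
  have s: "set ys = set (x # xs)" using Cons.prems(1) by (metis set_mset_mset)
  then obtain us vs where ys: "ys = us @ x # vs" by (metis list.set_intros(1) split_list)
  have m: "mset xs = mset (us @ vs)" using Cons.prems(1) ys by simp
  have c: "x \<in> carrier G" "set us \<subseteq> carrier G" "set vs \<subseteq> carrier G"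
    using s ys Cons.prems(2) by auto
  have "lprod ys = (lprod us \<otimes> x) \<otimes> lprod vs" using c ys by (simp add: lprod_append m_assoc)
  also have "\<dots> = (x \<otimes> lprod us) \<otimes> lprod vs"
    using lprod_commutes[of x us] c s ys Cons.prems(3) by (metis Un_iff list.set_intros(1) set_append)
  also have "\<dots> = x \<otimes> lprod (us @ vs)" using c by (simp add: lprod_append m_assoc)
  also have "\<dots> = x \<otimes> lprod xs" using Cons.IH[OF m] Cons.prems by simp
  finally show ?case by simp
qed simp

end

lemma mset_concat_replicate: "mset (concat (replicate n xs)) = repeat_mset n (mset xs)"
  by (induction n) auto

section \<open>Class semigroups\<close>

lemma (in comm_monoid) cong_class_eq_iff:
  assumes "x \<in> carrier G" "y \<in> carrier G"
  shows "cong_class H G x = cong_class H G y \<longleftrightarrow>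
    (\<forall>z \<in> carrier G. x \<otimes> z \<in> H \<longleftrightarrow> y \<otimes> z \<in> H)"
  using eq_equiv_class_iff[OF equiv_class_rel, of x y H] assms
  by (simp add: cong_class_def) (simp add: class_rel_def)

text \<open>The hypothesis makes the powers of \<open>x\<close> periodic with period
  \<open>m\<close> from exponent 1 on, so \<open>x [^] m\<close> is neutral for them. Exponent 0 is
  excluded because it gives the identity of the whole monoid.\<close>

lemma (in monoid) group_of_powers:
  assumes x: "x \<in> carrier G" and p: "x [^] Suc m = x" and m: "m > (0::nat)"
  shows "group (G\<lparr>carrier := {x [^] k | k. k > (0::nat)}, one := x [^] m\<rparr>)"
proof -
  have per: "x [^] (n + m) = x [^] n" if "n > 0" for n
  proof -
    obtain k where k: "n = Suc k" using \<open>n > 0\<close> gr0_implies_Suc by blast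
    have "x [^] (n + m) = x [^] k \<otimes> x [^] Suc m"
      using x nat_pow_mult[of x k "Suc m"] by (simp add: k del: nat_pow_Suc)
    then show ?thesis using p k by simp
  qed
  have per': "x [^] (i * m + m) = x [^] m" for i
  proof (induction i)
    case (Suc i)
    have "x [^] (Suc i * m + m) = x [^] ((i * m + m) + m)" by (simp add: algebra_simps)
    then show ?case using per[of "i * m + m"] m Suc by simp
  qed simp
  show ?thesis
  proof (rule groupI, goal_cases)
    case (1 a b)
    then show ?case using x by (auto simp: nat_pow_mult)
  next
    case 2
    then show ?case using m by auto
  next
    case (3 a b c)
    then show ?case using x by (auto simp: m_assoc)
  next
    case (4 a)
    then show ?case using x by (auto simp: nat_pow_mult add.commute per)
  next
    case (5 a)
    then obtain k :: nat where k: "a = x [^] k" "k > 0" by auto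
    \<comment> \<open>This exponent is \<open>-k\<close> modulo \<open>m\<close>. The subtraction is
      not truncated since \<open>m > 0\<close>, and the summand \<open>m\<close> keeps the exponent
      positive also for \<open>m = 1\<close>.\<close>
    let ?j = "k * m - k + m"
    have "?j + k = k * m + m" using m by (cases m) auto
    then have "x [^] ?j \<otimes> x [^] k = x [^] m"
      using x per'[of k] nat_pow_mult[of x ?j k] by metis
    then show ?case using k m by (auto intro!: exI[of _ ?j])
  qed
qed

section \<open>Product-one sequences\<close>

lemma carrier_free_comm_monoid [simp]: "S \<in> carrier (free_comm_monoid A) \<longleftrightarrow> set_mset S \<subseteq> A"
  and mult_free_comm_monoid [simp]: "S \<otimes>\<^bsub>free_comm_monoid A\<^esub> T = S + T"
  and one_free_comm_monoid [simp]: "\<one>\<^bsub>free_comm_monoid A\<^esub> = {#}"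
  by (auto simp: free_comm_monoid_def)

lemma comm_monoid_free_comm_monoid: "comm_monoid (free_comm_monoid A)"
  by (rule comm_monoidI) (auto simp: add_ac)

lemma carrier_product_one_monoid [simp]: "carrier (product_one_monoid G) = product_one_seqs G"
  and mult_product_one_monoid [simp]: "S \<otimes>\<^bsub>product_one_monoid G\<^esub> T = S + T"
  and one_product_one_monoid [simp]: "\<one>\<^bsub>product_one_monoid G\<^esub> = {#}"
  by (auto simp: product_one_monoid_def free_comm_monoid_def)

lemma repeat_mset_subset: "set_mset S \<subseteq> A \<Longrightarrow> set_mset (repeat_mset n S) \<subseteq> A"
  by (induction n) auto

lemma (in comm_monoid_cancel) quotient_group_pow:
  assumes "a \<in> carrier G" "b \<in> carrier G"
  shows "fraction G a b [^]\<^bsub>quotient_group G\<^esub> (n::nat) = fraction G (a [^] n) (b [^] n)"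
proof (induction n)
  case 0
  then show ?case by (simp add: nat_pow_def) (simp add: quotient_group_def)
next
  case (Suc n)
  have "fraction G a b [^]\<^bsub>quotient_group G\<^esub> Suc n =
      fraction G a b [^]\<^bsub>quotient_group G\<^esub> n \<otimes>\<^bsub>quotient_group G\<^esub> fraction G a b"
    by (simp add: nat_pow_def)
  then show ?case using Suc assms by (simp add: quotient_group_mult)
qed

context group
begin

lemma product_one_seqs_iff:
  "S \<in> product_one_seqs G \<longleftrightarrow> set_mset S \<subseteq> carrier G \<and> (\<exists>xs. mset xs = S \<and> lprod xs = \<one>)"
  by (auto simp: product_one_seqs_def products_def lprod_def) metis

lemma product_one_seqsI:
  "set xs \<subseteq> carrier G \<Longrightarrow> lprod xs = \<one> \<Longrightarrow> mset xs \<in> product_one_seqs G"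
  by (auto simp: product_one_seqs_iff)

lemma product_one_seqsE:
  assumes "S \<in> product_one_seqs G"
  obtains xs where "S = mset xs" "set xs \<subseteq> carrier G" "lprod xs = \<one>"
  using assms by (auto simp: product_one_seqs_iff)

lemma empty_product_one [simp]: "{#} \<in> product_one_seqs G"
  using product_one_seqsI[of "[]"] by simp

lemma product_one_subset: "S \<in> product_one_seqs G \<Longrightarrow> set_mset S \<subseteq> carrier G"
  by (auto simp: product_one_seqs_iff)

lemma product_one_add:
  assumes "S \<in> product_one_seqs G" "T \<in> product_one_seqs G"
  shows "S + T \<in> product_one_seqs G"
proof -
  obtain xs ys where "S = mset xs" "set xs \<subseteq> carrier G" "lprod xs = \<one>"
    "T = mset ys" "set ys \<subseteq> carrier G" "lprod ys = \<one>"
    using assms by (metis product_one_seqsE)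
  then show ?thesis using product_one_seqsI[of "xs @ ys"] by (simp add: lprod_append)
qed

lemma product_one_repeat: "S \<in> product_one_seqs G \<Longrightarrow> repeat_mset n S \<in> product_one_seqs G"
  by (induction n) (auto intro: product_one_add)

lemma product_one_repeat_order:
  assumes "set_mset S \<subseteq> carrier G"
  shows "repeat_mset (order G) S \<in> product_one_seqs G"
proof -
  obtain xs where xs: "mset xs = S" using ex_mset by blast
  then have "set xs \<subseteq> carrier G" using assms by auto
  then show ?thesis
    using product_one_seqsI[of "concat (replicate (order G) xs)"] xs
    by (simp add: lprod_concat_replicate pow_order_eq_1 mset_concat_replicate UN_subset_iff)
qed

lemma comm_monoid_cancel_product_one_monoid: "comm_monoid_cancel (product_one_monoid G)"
proof -
  have "comm_monoid (product_one_monoid G)"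
    by (rule comm_monoidI) (auto simp: add_ac product_one_add)
  then show ?thesis by (rule comm_monoid_cancelI) simp
qed

lemma product_one_monoid_pow:
  "S [^]\<^bsub>product_one_monoid G\<^esub> (n::nat) = repeat_mset n S"
  by (induction n) (auto simp: nat_pow_def add.commute)

text \<open>A fraction whose square is a sequence is itself a sequence over the group, so only
  sequences \<open>S\<close> need testing. The sequence \<open>A\<close> witnesses that
  \<open>S\<close>, as the fraction of \<open>S + A\<close> by \<open>A\<close>, lies in the
  quotient group.\<close>

lemma seminormal_product_one_iff:
  "seminormal_monoid (product_one_monoid G) \<longleftrightarrow>
    (\<forall>S A. A \<in> product_one_seqs G \<longrightarrow> S + A \<in> product_one_seqs G \<longrightarrow>
      repeat_mset 2 S \<in> product_one_seqs G \<longrightarrow> repeat_mset 3 S \<in> product_one_seqs G \<longrightarrow>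
      S \<in> product_one_seqs G)" (is "?L \<longleftrightarrow> ?R")
proof -
  interpret P: comm_monoid_cancel "product_one_monoid G"
    by (rule comm_monoid_cancel_product_one_monoid)
  let ?P = "product_one_monoid G" and ?B = "product_one_seqs G"
  let ?Q = "quotient_group ?P"
  have emb: "fraction ?P a b \<in> quotient_embed ?P ` ?B \<longleftrightarrow> (\<exists>c \<in> ?B. a = c + b)"
    if "a \<in> ?B" "b \<in> ?B" for a b
    using that by (auto simp: quotient_embed_def image_iff P.fraction_eq_iff)
  have carQ: "carrier ?Q = {fraction ?P a b | a b. a \<in> ?B \<and> b \<in> ?B}"
    by (simp add: quotient_group_def)
  have pow: "fraction ?P a b [^]\<^bsub>?Q\<^esub> (n::nat) = fraction ?P (repeat_mset n a) (repeat_mset n b)"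
    if "a \<in> ?B" "b \<in> ?B" for a b n
    using that by (simp add: P.quotient_group_pow product_one_monoid_pow)
  have embp: "fraction ?P a b [^]\<^bsub>?Q\<^esub> (n::nat) \<in> quotient_embed ?P ` ?B \<longleftrightarrow>
      (\<exists>c \<in> ?B. repeat_mset n a = c + repeat_mset n b)" if "a \<in> ?B" "b \<in> ?B" for a b n
    using that by (simp add: pow emb product_one_repeat)
  have L: "?L \<longleftrightarrow> (\<forall>a \<in> ?B. \<forall>b \<in> ?B.
      (\<exists>c \<in> ?B. repeat_mset 2 a = c + repeat_mset 2 b) \<longrightarrow>
      (\<exists>c \<in> ?B. repeat_mset 3 a = c + repeat_mset 3 b) \<longrightarrow> (\<exists>c \<in> ?B. a = c + b))"
    (is "_ \<longleftrightarrow> ?R'")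
  proof -
    have *: "(\<forall>x \<in> carrier ?Q. P x) \<longleftrightarrow> (\<forall>a \<in> ?B. \<forall>b \<in> ?B. P (fraction ?P a b))" for P
      by (auto simp: carQ)
    have "?L \<longleftrightarrow> (\<forall>a \<in> ?B. \<forall>b \<in> ?B.
        fraction ?P a b [^]\<^bsub>?Q\<^esub> (2::nat) \<in> quotient_embed ?P ` ?B \<longrightarrow>
        fraction ?P a b [^]\<^bsub>?Q\<^esub> (3::nat) \<in> quotient_embed ?P ` ?B \<longrightarrow>
        fraction ?P a b \<in> quotient_embed ?P ` ?B)"
      unfolding seminormal_monoid_def carrier_product_one_monoid
      by (simp only: * comm_monoid_cancel_product_one_monoid simp_thms)
    also have "\<dots> \<longleftrightarrow> ?R'"
      by (intro ball_cong refl) (simp only: embp emb)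
    finally show ?thesis .
  qed
  show ?thesis
  proof
    assume l: ?L
    show ?R
    proof (intro allI impI)
      fix S A
      assume A: "A \<in> ?B" "S + A \<in> ?B" and S: "repeat_mset 2 S \<in> ?B" "repeat_mset 3 S \<in> ?B"
      have "\<exists>c \<in> ?B. repeat_mset n (S + A) = c + repeat_mset n A" if "repeat_mset n S \<in> ?B" for n
        using that repeat_mset_distrib2 by blast
      from l[unfolded L, rule_format, OF A(2,1) this[OF S(1)] this[OF S(2)]]
      obtain c where "c \<in> ?B" "S + A = c + A" by blast
      then show "S \<in> ?B" by simp
    qed
  next
    assume r: ?R
    show ?L unfolding L
    proof (intro ballI impI)
      fix a b
      assume ab: "a \<in> ?B" "b \<in> ?B"
        and 2: "\<exists>c \<in> ?B. repeat_mset 2 a = c + repeat_mset 2 b"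
        and 3: "\<exists>c \<in> ?B. repeat_mset 3 a = c + repeat_mset 3 b"
      \<comment> \<open>Comparing multiplicities in the doubled sequences shows that
        \<open>b\<close> divides \<open>a\<close>.\<close>
      from 2 have "repeat_mset 2 b \<subseteq># repeat_mset 2 a" by (metis mset_subset_eq_add_right)
      then have "count b x \<le> count a x" for x
        using mset_subset_eq_count[of "repeat_mset 2 b" "repeat_mset 2 a" x] by simp
      then have "b \<subseteq># a" by (intro mset_subset_eqI)
      then obtain S where S: "a = S + b" by (metis subset_mset.diff_add)
      have "repeat_mset n S \<in> ?B" if "\<exists>c \<in> ?B. repeat_mset n a = c + repeat_mset n b" for n
        using that unfolding S repeat_mset_distrib2 by (metis add_right_cancel)
      with 2 3 have "repeat_mset 2 S \<in> ?B" "repeat_mset 3 S \<in> ?B" by blast+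
      with r S ab show "\<exists>c \<in> ?B. a = c + b" by blast
    qed
  qed
qed

text \<open>Every \<open>n \<ge> m * m\<close> is a nonnegative combination of \<open>m\<close> and
  \<open>Suc m\<close>, so all large multiples of \<open>S\<close> are product-one. The threshold
  then descends: if all multiples beyond \<open>k \<ge> 1\<close> are product-one, so are those by
  \<open>2 * k\<close> and \<open>3 * k\<close>, and seminormality yields the one by
  \<open>k\<close>.\<close>

lemma seminormal_product_one_root:
  assumes sn: "seminormal_monoid (product_one_monoid G)" and m: "m > 0"
    and S: "repeat_mset m S \<in> product_one_seqs G" "repeat_mset (Suc m) S \<in> product_one_seqs G"
  shows "S \<in> product_one_seqs G"
proof -
  let ?B = "product_one_seqs G"
  have rr: "repeat_mset (i * j) S = repeat_mset i (repeat_mset j S)" for i j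
    by (simp add: mult.commute)
  have large: "repeat_mset n S \<in> ?B" if "n \<ge> m * m" for n
  proof -
    \<comment> \<open>With quotient \<open>q\<close> and remainder \<open>r \<le> q\<close>,
      \<open>n = q * m + r\<close> becomes \<open>(q - r) * m + r * Suc m\<close>.\<close>
    have "n mod m \<le> n div m"
      using that m div_le_mono[of "m * m" n m] mod_less_divisor[OF m, of n] by simp
    then obtain d where d: "n div m = n mod m + d" using le_Suc_ex by blast
    have "n = (n div m) * m + n mod m" by simp
    also have "\<dots> = (n div m - n mod m) * m + (n mod m) * Suc m"
      by (simp add: d algebra_simps)
    finally have "n = (n div m - n mod m) * m + (n mod m) * Suc m" .
    then have "repeat_mset n S = repeat_mset ((n div m - n mod m) * m + (n mod m) * Suc m) S"
      by (rule arg_cong)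
    also have "\<dots> = repeat_mset (n div m - n mod m) (repeat_mset m S) +
        repeat_mset (n mod m) (repeat_mset (Suc m) S)"
      by (simp only: repeat_mset_distrib rr)
    finally have "repeat_mset n S = \<dots>" .
    then show ?thesis using S by (simp only: product_one_add product_one_repeat)
  qed
  have step: "repeat_mset n S \<in> ?B" if "k \<ge> 1" "\<And>n. n > k \<Longrightarrow> repeat_mset n S \<in> ?B" "n \<ge> k" for k n
  proof (cases "n = k")
    case True
    \<comment> \<open>This places the \<open>k\<close>-fold multiple of \<open>S\<close> in the
      quotient group, with the \<open>k * m\<close>-fold multiple as denominator.\<close>
    have "repeat_mset k S + repeat_mset (k * m) S = repeat_mset (k * Suc m) S"
      by (simp add: repeat_mset_distrib[symmetric])
    then have "repeat_mset k S + repeat_mset (k * m) S \<in> ?B" "repeat_mset (k * m) S \<in> ?B"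
      using S by (simp_all only: rr product_one_repeat)
    moreover have "repeat_mset 2 (repeat_mset k S) \<in> ?B" "repeat_mset 3 (repeat_mset k S) \<in> ?B"
      using that(1) that(2)[of "2 * k"] that(2)[of "3 * k"] by simp_all
    ultimately show ?thesis using sn seminormal_product_one_iff True by blast
  qed (use that in auto)
  have "repeat_mset 1 S \<in> ?B" if "\<And>n. n > k \<Longrightarrow> repeat_mset n S \<in> ?B" for k
    using that
  proof (induction k)
    case 0
    then show ?case using zero_less_one by metis
  next
    case (Suc k)
    show ?case
    proof (rule Suc.IH)
      fix n assume "n > k"
      then show "repeat_mset n S \<in> ?B" using step[of "Suc k" n] Suc.prems by simp
    qed
  qed
  from this[of "m * m"] large have "repeat_mset 1 S \<in> ?B" by simp
  then show ?thesis by simp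
qed

end

section \<open>Groups with at most one nontrivial commutator\<close>

text \<open>The convention agrees with the generators in \<open>derived_set\<close>.\<close>

definition (in group) commutator :: "'a \<Rightarrow> 'a \<Rightarrow> 'a"
  where "commutator a b = a \<otimes> b \<otimes> inv a \<otimes> inv b"

context group
begin

lemma mult_inv_cancel [simp]:
  assumes "a \<in> carrier G" "b \<in> carrier G"
  shows "a \<otimes> (inv a \<otimes> b) = b" "inv a \<otimes> (a \<otimes> b) = b"
  using assms by (simp_all add: m_assoc[symmetric])

lemma commutator_closed [simp]:
  "a \<in> carrier G \<Longrightarrow> b \<in> carrier G \<Longrightarrow> commutator a b \<in> carrier G"
  by (simp add: commutator_def)

lemma commutator_mult:
  assumes "a \<in> carrier G" "b \<in> carrier G"
  shows "commutator a b \<otimes> (b \<otimes> a) = a \<otimes> b"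
  using assms by (simp add: commutator_def m_assoc)

lemma commutator_unique:
  assumes "a \<in> carrier G" "b \<in> carrier G" "x \<in> carrier G" "x \<otimes> (b \<otimes> a) = a \<otimes> b"
  shows "commutator a b = x"
  using assms commutator_mult[of a b] by (metis commutator_closed m_closed r_cancel)

lemma commutator_in_derived:
  "a \<in> carrier G \<Longrightarrow> b \<in> carrier G \<Longrightarrow> commutator a b \<in> derived G (carrier G)"
  unfolding derived_def commutator_def by (auto intro!: generate.incl)

text \<open>If the derived subgroup is \<open>{\<one>, z}\<close>, normality forces every conjugate
  of \<open>z\<close> to be \<open>z\<close>, since it cannot be \<open>\<one>\<close>. Conversely,
  \<open>{\<one>, z}\<close> is a subgroup containing all generators of the derived
  subgroup.\<close>

lemma card_derived_le_2_iff:
  assumes fin: "finite (carrier G)"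
  shows "card (derived G (carrier G)) \<le> 2 \<longleftrightarrow>
    (\<exists>z \<in> carrier G. z \<otimes> z = \<one> \<and> (\<forall>a \<in> carrier G. z \<otimes> a = a \<otimes> z) \<and>
      (\<forall>a \<in> carrier G. \<forall>b \<in> carrier G. commutator a b \<in> {\<one>, z}))" (is "?L \<longleftrightarrow> ?R")
proof
  let ?D = "derived G (carrier G)"
  interpret D: normal ?D G by (rule derived_self_is_normal)
  have Dc: "?D \<subseteq> carrier G" by (rule D.subset)
  then have finD: "finite ?D" using fin finite_subset by blast
  assume l: ?L
  show ?R
  proof (cases "?D = {\<one>}")
    case True
    then show ?thesis using commutator_in_derived by (intro bexI[of _ \<one>]) auto
  next
    case False
    then obtain z where z: "z \<in> ?D" "z \<noteq> \<one>" using D.one_closed by blast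
    have D: "?D = {\<one>, z}"
      using card_seteq[OF finD, of "{\<one>, z}"] z l D.one_closed by auto
    have zc: "z \<in> carrier G" using z Dc by auto
    have "z \<otimes> z \<in> {\<one>, z}" using D z D.m_closed by metis
    then have zz: "z \<otimes> z = \<one>" using z zc by (metis insertE l_cancel_one' singletonD)
    have cen: "z \<otimes> a = a \<otimes> z" if a: "a \<in> carrier G" for a
    proof -
      have "a \<otimes> z \<otimes> inv a \<in> {\<one>, z}" using D z D.inv_op_closed2[OF a] by metis
      moreover have "a \<otimes> z \<otimes> inv a \<noteq> \<one>"
        using a zc z by (metis inv_closed inv_equality inv_inv l_cancel_one m_closed)
      ultimately have "a \<otimes> z \<otimes> inv a = z" by simp
      then show ?thesis using a zc by (metis inv_solve_right m_closed)
    qed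
    show ?thesis using zz cen zc commutator_in_derived D by blast
  qed
next
  assume ?R
  then obtain z where z: "z \<in> carrier G" "z \<otimes> z = \<one>"
    and c: "\<And>a b. a \<in> carrier G \<Longrightarrow> b \<in> carrier G \<Longrightarrow> commutator a b \<in> {\<one>, z}"
    by blast
  have "inv z = z" using z by (simp add: inv_equality)
  then have "subgroup {\<one>, z} G" using z by unfold_locales auto
  moreover have "derived_set G (carrier G) \<subseteq> {\<one>, z}"
    using c unfolding commutator_def by blast
  ultimately have "derived G (carrier G) \<subseteq> {\<one>, z}"
    unfolding derived_def by (rule generate_subgroup_incl[rotated])
  then have "card (derived G (carrier G)) \<le> card {\<one>, z}" by (rule card_mono[rotated]) simp
  also have "\<dots> \<le> 2" by (simp add: card_insert_if)
  finally show ?L .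
qed

end

text \<open>Working form of the bound on the derived subgroup; \<open>z = \<one>\<close> is allowed
  and covers abelian groups.\<close>

locale central_commutators = group +
  fixes z
  assumes z_closed [simp]: "z \<in> carrier G" and z_square: "z \<otimes> z = \<one>"
    and z_central: "a \<in> carrier G \<Longrightarrow> z \<otimes> a = a \<otimes> z"
    and commutator_cases: "a \<in> carrier G \<Longrightarrow> b \<in> carrier G \<Longrightarrow> commutator a b \<in> {\<one>, z}"
begin

lemma z_mult_cancel [simp]: "a \<in> carrier G \<Longrightarrow> z \<otimes> (z \<otimes> a) = a"
  by (simp add: m_assoc[symmetric] z_square)

lemma mult_swap:
  assumes "a \<in> carrier G" "b \<in> carrier G"
  shows "a \<otimes> b = b \<otimes> a \<or> a \<otimes> b = z \<otimes> (b \<otimes> a)"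
  using commutator_mult[OF assms] commutator_cases[OF assms] assms
  by (metis insertE l_one m_closed singletonD)

text \<open>The head of \<open>xs\<close> is swapped with the whole block preceding it in
  \<open>ys\<close>, at the cost of at most one factor \<open>z\<close>. The tail contributes at
  most one more, and \<open>z \<otimes> z = \<one>\<close>.\<close>

lemma lprod_mset_cases:
  assumes "mset xs = mset ys" "set xs \<subseteq> carrier G"
  shows "lprod ys \<in> {lprod xs, z \<otimes> lprod xs}"
  using assms
proof (induction xs arbitrary: ys)
  case (Cons x xs)
  have s: "set ys = set (x # xs)" using Cons.prems(1) by (metis set_mset_mset)
  then obtain us vs where ys: "ys = us @ x # vs" by (metis list.set_intros(1) split_list)
  have m: "mset xs = mset (us @ vs)" using Cons.prems(1) ys by simp
  have c: "x \<in> carrier G" "set us \<subseteq> carrier G" "set vs \<subseteq> carrier G" "set xs \<subseteq> carrier G"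
    using s ys Cons.prems(2) by auto
  have "lprod ys = (lprod us \<otimes> x) \<otimes> lprod vs" using c ys by (simp add: lprod_append m_assoc)
  moreover have "x \<otimes> lprod (us @ vs) = (x \<otimes> lprod us) \<otimes> lprod vs"
    using c by (simp add: lprod_append m_assoc)
  moreover have "lprod us \<otimes> x = x \<otimes> lprod us \<or> lprod us \<otimes> x = z \<otimes> (x \<otimes> lprod us)"
    using c by (intro mult_swap) auto
  ultimately have 1: "lprod ys = x \<otimes> lprod (us @ vs) \<or> lprod ys = z \<otimes> (x \<otimes> lprod (us @ vs))"
    using c by (metis lprod_closed m_assoc m_closed z_closed)
  have "x \<otimes> (z \<otimes> lprod xs) = z \<otimes> (x \<otimes> lprod xs)"
    using c z_central[of x] by (simp add: m_assoc[symmetric])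
  then have "x \<otimes> lprod (us @ vs) \<in> {x \<otimes> lprod xs, z \<otimes> (x \<otimes> lprod xs)}"
    using Cons.IH[OF m] c by auto
  with 1 show ?case using c by auto
qed simp

text \<open>Two orderings that begin with \<open>a, b\<close> and \<open>b, a\<close> and then agree
  have products differing by the factor \<open>z\<close>. Both products lie in
  \<open>{\<one>, z}\<close>, so one of them is \<open>\<one>\<close>.\<close>

lemma product_one_if_noncommuting:
  assumes "mset xs = S" "set xs \<subseteq> carrier G" "lprod xs = z"
    and ab: "a \<in> set xs" "b \<in> set xs" "a \<otimes> b \<noteq> b \<otimes> a"
  shows "S \<in> product_one_seqs G"
proof -
  have "a \<noteq> b" using ab by auto
  obtain zs where zs: "mset zs = mset xs - {#a, b#}" using ex_mset by blast
  have "{#a, b#} \<subseteq># mset xs"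
    using ab \<open>a \<noteq> b\<close> by (simp add: insert_subset_eq_iff in_diff_count)
  then have "{#a, b#} + mset zs = mset xs" unfolding zs by (rule subset_mset.add_diff_inverse)
  then have m: "mset (a # b # zs) = mset xs" "mset (b # a # zs) = mset xs"
    by (simp_all add: add_mset_commute)
  have c: "a \<in> carrier G" "b \<in> carrier G" "set zs \<subseteq> carrier G"
    using m assms(2) by (metis insert_subset list.simps(15) set_mset_mset)+
  have "lprod (a # b # zs) = z \<otimes> lprod (b # a # zs)"
    using mult_swap[of a b] ab c by (auto simp: m_assoc[symmetric])
  moreover have "lprod (b # a # zs) \<in> {z, \<one>}"
    using lprod_mset_cases[of xs "b # a # zs"] m assms by (auto simp: z_square)
  ultimately have "lprod (a # b # zs) = \<one> \<or> lprod (b # a # zs) = \<one>"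
    using z_square by force
  then show ?thesis
    using m c assms(1) product_one_seqsI[of "a # b # zs"] product_one_seqsI[of "b # a # zs"] by auto
qed

text \<open>If the common product is not \<open>\<one>\<close>, it is \<open>z\<close>. Some
  ordering of \<open>xs\<close> has product \<open>\<one>\<close>, so the terms of \<open>xs\<close>
  do not all commute, and the same noncommuting pair occurs in \<open>ys\<close>.\<close>

lemma product_one_cong:
  assumes "set xs = set ys" "set xs \<subseteq> carrier G" "lprod xs = lprod ys"
    and "mset xs \<in> product_one_seqs G"
  shows "mset ys \<in> product_one_seqs G"
proof -
  obtain zs where zs: "mset xs = mset zs" "lprod zs = \<one>"
    using assms(4) by (metis product_one_seqsE)
  then have szs: "set zs = set xs" by (metis set_mset_mset)
  have "lprod xs \<in> {\<one>, z}"
    using lprod_mset_cases[of zs xs] zs szs assms(2) by simp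
  then consider "lprod ys = \<one>" | "lprod ys = z" "lprod xs \<noteq> \<one>" using assms(3) by auto
  then show ?thesis
  proof cases
    case 1
    then show ?thesis using assms by (intro product_one_seqsI) auto
  next
    case 2
    then obtain a b where "a \<in> set xs" "b \<in> set xs" "a \<otimes> b \<noteq> b \<otimes> a"
      using lprod_mset_cong[of zs xs] zs szs assms(2) by metis
    then show ?thesis using product_one_if_noncommuting[of ys] 2 assms by auto
  qed
qed

text \<open>Appending the same terms to both lists preserves equality of supports and of
  products.\<close>

lemma cong_class_eqI:
  assumes "set xs = set ys" "set xs \<subseteq> carrier G" "lprod xs = lprod ys"
  shows "cong_class (product_one_seqs G) (free_comm_monoid (carrier G)) (mset xs) =
    cong_class (product_one_seqs G) (free_comm_monoid (carrier G)) (mset ys)"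
proof -
  interpret F: comm_monoid "free_comm_monoid (carrier G)"
    by (rule comm_monoid_free_comm_monoid)
  have "mset xs + T \<in> product_one_seqs G \<longleftrightarrow> mset ys + T \<in> product_one_seqs G"
    if T: "set_mset T \<subseteq> carrier G" for T
  proof -
    obtain ts where ts: "mset ts = T" using ex_mset by blast
    then have "set ts \<subseteq> carrier G" using T by auto
    then show ?thesis
      using product_one_cong[of "xs @ ts" "ys @ ts"] product_one_cong[of "ys @ ts" "xs @ ts"]
        assms ts by (auto simp: lprod_append)
  qed
  then show ?thesis using assms by (subst F.cong_class_eq_iff) auto
qed

end

section \<open>Seminormality bounds the commutator subgroup\<close>

lemma mset_eq_2_iff: "mset ys = {#a, b#} \<longleftrightarrow> ys \<in> {[a, b], [b, a]}"
proof
  assume m: "mset ys = {#a, b#}"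
  then have "length ys = 2" by (metis size_mset size_add_mset size_empty numeral_2_eq_2)
  then obtain p q where "ys = [p, q]" by (auto simp: length_Suc_conv numeral_2_eq_2)
  then show "ys \<in> {[a, b], [b, a]}" using m by (auto simp: add_eq_conv_ex)
qed (auto simp: add_mset_commute)

lemma mset_eq_3D:
  assumes m: "mset ys = {#a, b, c#}"
  shows "ys \<in> {[a, b, c], [a, c, b], [b, a, c], [b, c, a], [c, a, b], [c, b, a]}"
proof -
  obtain p ps where ys: "ys = p # ps" using m by (cases ys) auto
  then have "p \<in># {#a, b, c#}" using m by (metis list.set_intros(1) set_mset_mset)
  then consider "p = a" | "p = b" | "p = c" by auto
  then show ?thesis
  proof cases
    case 1
    then have "mset ps = {#b, c#}" using m ys by simp
    then show ?thesis using 1 ys by (auto simp: mset_eq_2_iff)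
  next
    case 2
    then have "mset ps = {#a, c#}" using m ys by (simp add: add_mset_commute)
    then show ?thesis using 2 ys by (auto simp: mset_eq_2_iff)
  next
    case 3
    then have "mset ps = {#a, b#}" using m ys by (simp add: add_mset_commute[of _ c])
    then show ?thesis using 3 ys by (auto simp: mset_eq_2_iff)
  qed
qed

context group
begin

text \<open>A product equal to \<open>\<one>\<close> stays so under cyclic rotation, so
  \<open>inv u\<close> can be rotated to the front and moved to the other side.\<close>

lemma product_one_inv_addE:
  assumes "add_mset (inv u) T \<in> product_one_seqs G" "u \<in> carrier G"
  obtains ys where "mset ys = T" "lprod ys = u"
proof -
  obtain xs where xs: "mset xs = add_mset (inv u) T" "set xs \<subseteq> carrier G" "lprod xs = \<one>"
    using assms by (metis product_one_seqsE)
  then have "inv u \<in> set xs" by (metis set_mset_mset union_single_eq_member)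
  then obtain us vs where sp: "xs = us @ inv u # vs" by (metis split_list)
  have c: "set us \<subseteq> carrier G" "set vs \<subseteq> carrier G" using xs sp by auto
  have "lprod us \<otimes> (inv u \<otimes> lprod vs) = \<one>" using xs sp c assms by (simp add: lprod_append)
  then have "inv u \<otimes> lprod vs \<otimes> lprod us = \<one>" using c assms by (simp add: inv_comm)
  then have "lprod (vs @ us) = u"
    using c assms by (simp add: lprod_append m_assoc)
      (metis inv_equality inv_inv inv_comm inv_closed lprod_closed m_closed)
  moreover have "mset (vs @ us) = T" using xs sp by (simp add: add.commute)
  ultimately show ?thesis using that by blast
qed

end

locale seminormal_product_one_group = group +
  assumes finite_carrier: "finite (carrier G)"
    and seminormal: "seminormal_monoid (product_one_monoid G)"
begin

text \<open>The sequence \<open>V\<close> collects terms that occur once in the word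
  \<open>ws\<close>. Padding them with \<open>order G\<close> further copies does not affect
  product-one, and gives every term of \<open>S\<close> one more than \<open>order G\<close>
  copies.\<close>

lemma product_one_if_word:
  assumes "set ws \<subseteq> carrier G" "lprod ws = \<one>" "set_mset V \<subseteq> carrier G" "set_mset S \<subseteq> carrier G"
    and "mset ws + repeat_mset (order G) V = repeat_mset (Suc (order G)) S"
  shows "S \<in> product_one_seqs G"
proof (rule seminormal_product_one_root[OF seminormal])
  show "order G > 0" using finite_carrier order_gt_0_iff_finite by blast
  show "repeat_mset (order G) S \<in> product_one_seqs G" using assms by (intro product_one_repeat_order)
  show "repeat_mset (Suc (order G)) S \<in> product_one_seqs G"
    using assms product_one_add[OF product_one_seqsI product_one_repeat_order] by metis
qed

lemma obtain_pred_order: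
  obtains k where "order G = Suc k" "\<And>a. a \<in> carrier G \<Longrightarrow> a [^] k = inv a"
proof -
  have "order G > 0" using finite_carrier order_gt_0_iff_finite by blast
  then obtain k where k: "order G = Suc k" by (cases "order G") auto
  have "a [^] k = inv a" if "a \<in> carrier G" for a
    using pow_order_eq_1[OF that] that k inv_equality[of "a [^] k" a] by simp
  with k that show ?thesis by blast
qed

text \<open>The element \<open>u\<close> must equal \<open>a \<otimes> b\<close> or
  \<open>b \<otimes> a\<close>. Multiplying by \<open>a\<close> on the right, the first case makes
  \<open>a\<close> and \<open>b\<close> commute, and the second is the claim.\<close>

lemma square_commutes:
  assumes a: "a \<in> carrier G" and b: "b \<in> carrier G"
  shows "a \<otimes> a \<otimes> b = b \<otimes> (a \<otimes> a)"
proof -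
  obtain k where k: "order G = Suc k" "a [^] k = inv a" using obtain_pred_order a by metis
  define u where "u = a \<otimes> a \<otimes> b \<otimes> inv a"
  have u: "u \<in> carrier G" using a b by (simp add: u_def)
  have "{#inv u, a, b#} \<in> product_one_seqs G"
  proof (rule product_one_if_word)
    \<comment> \<open>The \<open>k\<close> trailing copies of \<open>a\<close> spell
      \<open>inv a\<close>, so \<open>a\<close> occurs \<open>k + 2 = Suc (order G)\<close>
      times.\<close>
    let ?ws = "[inv u, a, a, b] @ replicate k a"
    show "lprod ?ws = \<one>"
      using a b u k by (simp add: lprod_append lprod_replicate) (simp add: u_def m_assoc inv_mult_group)
    show "mset ?ws + repeat_mset (order G) {#inv u, b#} = repeat_mset (Suc (order G)) {#inv u, a, b#}"
      using k by (intro multiset_eqI) auto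
  qed (use a b u in auto)
  then obtain ys where ys: "mset ys = {#a, b#}" "lprod ys = u"
    using product_one_inv_addE u by metis
  then consider "a \<otimes> b = u" | "b \<otimes> a = u" using a b by (auto simp: mset_eq_2_iff)
  then show ?thesis
  proof cases
    case 1
    then have "a \<otimes> b \<otimes> a = u \<otimes> a" by simp
    then have "a \<otimes> b \<otimes> a = a \<otimes> a \<otimes> b" using a b by (simp add: u_def m_assoc)
    then have "b \<otimes> a = a \<otimes> b" using a b by (simp add: m_assoc)
    then show ?thesis using a b by (metis m_assoc)
  next
    case 2
    then have "b \<otimes> a \<otimes> a = u \<otimes> a" by simp
    then show ?thesis using a b by (simp add: u_def m_assoc)
  qed
qed

text \<open>Squares are central, and \<open>commutator a b\<close> times the squares of
  \<open>a\<close> and \<open>b\<close> is the square of \<open>a \<otimes> b\<close>.\<close>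

lemma commutator_central:
  assumes "a \<in> carrier G" "b \<in> carrier G" "x \<in> carrier G"
  shows "commutator a b \<otimes> x = x \<otimes> commutator a b"
proof -
  let ?c = "commutator a b" and ?A = "a \<otimes> a" and ?B = "b \<otimes> b" and ?P = "(a \<otimes> b) \<otimes> (a \<otimes> b)"
  have c: "?c \<in> carrier G" using assms by simp
  have "?c \<otimes> (?A \<otimes> ?B) = a \<otimes> b \<otimes> inv a \<otimes> (inv b \<otimes> ?A) \<otimes> ?B"
    using assms by (simp add: commutator_def m_assoc)
  also have "inv b \<otimes> ?A = ?A \<otimes> inv b" using assms by (simp add: square_commutes)
  finally have P: "?c \<otimes> (?A \<otimes> ?B) = ?P" using assms by (simp add: m_assoc)
  have AB: "?A \<otimes> ?B \<otimes> x = x \<otimes> (?A \<otimes> ?B)"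
    using assms square_commutes[of a x] square_commutes[of b x] by (metis m_assoc m_closed)
  have "?c \<otimes> x \<otimes> (?A \<otimes> ?B) = ?c \<otimes> (?A \<otimes> ?B) \<otimes> x" using AB c assms by (simp add: m_assoc)
  also have "\<dots> = x \<otimes> ?P" unfolding P using assms by (intro square_commutes) auto
  also have "\<dots> = x \<otimes> ?c \<otimes> (?A \<otimes> ?B)" unfolding P[symmetric] using c assms by (simp add: m_assoc)
  finally show ?thesis using c assms by (metis m_closed r_cancel)
qed

lemma commutator_lcomm:
  assumes "a \<in> carrier G" "b \<in> carrier G" "x \<in> carrier G" "y \<in> carrier G"
  shows "x \<otimes> (commutator a b \<otimes> y) = commutator a b \<otimes> (x \<otimes> y)"
  using assms commutator_central[of a b x] by (simp add: m_assoc[symmetric])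

text \<open>Moving \<open>b\<close> to the left past both factors in
  \<open>a \<otimes> a \<otimes> b\<close> produces the commutator twice, while
  \<open>a \<otimes> a\<close> commutes with \<open>b\<close>.\<close>

lemma commutator_square [simp]:
  assumes "a \<in> carrier G" "b \<in> carrier G"
  shows "commutator a b \<otimes> commutator a b = \<one>"
proof -
  let ?c = "commutator a b"
  have "a \<otimes> a \<otimes> b = a \<otimes> (?c \<otimes> (b \<otimes> a))" using assms by (simp add: commutator_mult m_assoc)
  also have "\<dots> = ?c \<otimes> (a \<otimes> b \<otimes> a)" using assms commutator_lcomm[of a b a] by (simp add: m_assoc)
  also have "\<dots> = ?c \<otimes> (?c \<otimes> (b \<otimes> a) \<otimes> a)" using assms by (simp add: commutator_mult)
  also have "\<dots> = ?c \<otimes> ?c \<otimes> (b \<otimes> (a \<otimes> a))" using assms by (simp add: m_assoc)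
  also have "b \<otimes> (a \<otimes> a) = a \<otimes> a \<otimes> b" using assms by (simp add: square_commutes)
  finally show ?thesis using r_cancel_one'[of "a \<otimes> a \<otimes> b" "?c \<otimes> ?c"] assms by simp
qed

lemma commutator_cancel [simp]:
  "a \<in> carrier G \<Longrightarrow> b \<in> carrier G \<Longrightarrow> x \<in> carrier G \<Longrightarrow>
    commutator a b \<otimes> (commutator a b \<otimes> x) = x"
  by (simp add: m_assoc[symmetric])

lemma commutator_swap: "a \<in> carrier G \<Longrightarrow> b \<in> carrier G \<Longrightarrow> commutator b a = commutator a b"
  by (rule commutator_unique) (auto simp flip: commutator_mult[of a b])

lemma commutator_self: "a \<in> carrier G \<Longrightarrow> commutator a a = \<one>"
  by (rule commutator_unique) auto

lemma commutator_mult_left: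
  assumes "x \<in> carrier G" "y \<in> carrier G" "w \<in> carrier G"
  shows "commutator (x \<otimes> y) w = commutator x w \<otimes> commutator y w"
proof (rule commutator_unique)
  have "x \<otimes> y \<otimes> w = x \<otimes> (commutator y w \<otimes> (w \<otimes> y))"
    using assms by (simp add: commutator_mult m_assoc)
  also have "\<dots> = commutator y w \<otimes> (x \<otimes> w \<otimes> y)"
    using assms commutator_lcomm[of y w x] by (simp add: m_assoc)
  also have "x \<otimes> w = commutator x w \<otimes> (w \<otimes> x)" using assms by (simp add: commutator_mult)
  also have "commutator y w \<otimes> (commutator x w \<otimes> (w \<otimes> x) \<otimes> y) =
      commutator y w \<otimes> (commutator x w \<otimes> (w \<otimes> (x \<otimes> y)))"
    using assms by (simp add: m_assoc)
  also have "\<dots> = commutator x w \<otimes> commutator y w \<otimes> (w \<otimes> (x \<otimes> y))"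
    using assms commutator_lcomm[of x w "commutator y w"] by (simp add: m_assoc)
  finally show "commutator x w \<otimes> commutator y w \<otimes> (w \<otimes> (x \<otimes> y)) = x \<otimes> y \<otimes> w" ..
qed (use assms in auto)

lemma commutator_mult_right:
  assumes "x \<in> carrier G" "y \<in> carrier G" "w \<in> carrier G"
  shows "commutator w (x \<otimes> y) = commutator w x \<otimes> commutator w y"
  using assms commutator_mult_left[of x y w] by (simp add: commutator_swap[of w])

text \<open>With \<open>a\<close>, \<open>b\<close>, \<open>c\<close> for the three commutators, the
  six orderings of \<open>x, y, w\<close> have products \<open>x y w\<close> times \<open>1\<close>,
  \<open>b\<close>, \<open>a\<close>, \<open>ca\<close>, \<open>cb\<close>, \<open>cab\<close>. The
  word equals \<open>c\<close> times \<open>x y w\<close>, and the last three values would force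
  \<open>a = 1\<close>, \<open>b = 1\<close> or \<open>a = b\<close>.\<close>

lemma commutator_triple:
  assumes c: "x \<in> carrier G" "y \<in> carrier G" "w \<in> carrier G"
    and n: "commutator x y \<noteq> \<one>" "commutator y w \<noteq> \<one>" "commutator x y \<noteq> commutator y w"
  shows "commutator x w \<in> {\<one>, commutator x y, commutator y w}"
proof -
  let ?a = "commutator x y" and ?b = "commutator y w" and ?c = "commutator x w"
  let ?p = "x \<otimes> (y \<otimes> w)"
  obtain k where k: "order G = Suc k" "\<And>a. a \<in> carrier G \<Longrightarrow> a [^] k = inv a"
    using obtain_pred_order by metis
  define u where "u = x \<otimes> y \<otimes> w \<otimes> ?c"
  have u: "u \<in> carrier G" using c by (simp add: u_def)
  have "{#inv u, x, y, w#} \<in> product_one_seqs G"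
  proof (rule product_one_if_word)
    \<comment> \<open>After \<open>inv u, x, y, w\<close>, the remaining terms spell the commutator
      of \<open>x\<close> and \<open>w\<close>, with \<open>k\<close> copies replacing each
      inverse.\<close>
    let ?ws = "[inv u, x, y, w, x, w] @ replicate k x @ replicate k w"
    have "lprod (replicate k x @ replicate k w) = inv x \<otimes> inv w"
      using c k(2) by (subst lprod_append) (auto simp: lprod_replicate)
    then have "lprod ?ws = inv u \<otimes> u"
      using c u by simp (simp add: u_def commutator_def m_assoc)
    then show "lprod ?ws = \<one>" using u by simp
    show "mset ?ws + repeat_mset (order G) {#inv u, y#} = repeat_mset (Suc (order G)) {#inv u, x, y, w#}"
      using k by (intro multiset_eqI) auto
  qed (use c u in auto)
  then obtain ys where ys: "mset ys = {#x, y, w#}" "lprod ys = u"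
    using product_one_inv_addE u by metis
  have yx: "y \<otimes> x = ?a \<otimes> (x \<otimes> y)" and wy: "w \<otimes> y = ?b \<otimes> (y \<otimes> w)" and wx: "w \<otimes> x = ?c \<otimes> (x \<otimes> w)"
    using c commutator_mult[of y x] commutator_mult[of w y] commutator_mult[of w x]
    by (simp_all add: commutator_swap[of x y] commutator_swap[of y w] commutator_swap[of x w])
  have "x \<otimes> (w \<otimes> y) = ?b \<otimes> ?p"
    unfolding wy using c commutator_lcomm[of y w x] by simp
  moreover have yxw: "y \<otimes> (x \<otimes> w) = ?a \<otimes> ?p"
    using c arg_cong[OF yx, of "\<lambda>v. v \<otimes> w"] by (simp add: m_assoc)
  moreover have "y \<otimes> (w \<otimes> x) = ?c \<otimes> ?a \<otimes> ?p"
    unfolding wx using c commutator_lcomm[of x w y] yxw by (simp add: m_assoc)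
  moreover have wxy: "w \<otimes> (x \<otimes> y) = ?c \<otimes> ?b \<otimes> ?p"
  proof -
    have "w \<otimes> (x \<otimes> y) = ?c \<otimes> (x \<otimes> (w \<otimes> y))"
      using c arg_cong[OF wx, of "\<lambda>v. v \<otimes> y"] by (simp add: m_assoc)
    then show ?thesis unfolding wy using c commutator_lcomm[of y w x] by (simp add: m_assoc)
  qed
  moreover have "w \<otimes> (y \<otimes> x) = ?c \<otimes> (?a \<otimes> ?b) \<otimes> ?p"
    unfolding yx using c commutator_lcomm[of x y w] commutator_lcomm[of x y ?c] wxy
    by (simp add: m_assoc)
  ultimately have "lprod ys \<in> {\<one> \<otimes> ?p, ?b \<otimes> ?p, ?a \<otimes> ?p, ?c \<otimes> ?a \<otimes> ?p, ?c \<otimes> ?b \<otimes> ?p, ?c \<otimes> (?a \<otimes> ?b) \<otimes> ?p}"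
    using mset_eq_3D[OF ys(1)] c by auto
  moreover have "u = ?c \<otimes> ?p" using c commutator_central[of x w ?p] by (simp add: u_def m_assoc)
  ultimately have "?c \<in> {\<one>, ?b, ?a, ?c \<otimes> ?a, ?c \<otimes> ?b, ?c \<otimes> (?a \<otimes> ?b)}"
    using c ys(2) by (simp del: l_one)
  moreover have "?a \<otimes> ?b \<noteq> \<one>"
    using n c by (metis commutator_closed commutator_square inv_equality)
  ultimately show ?thesis using n c by auto
qed

lemma commutator_adjacent:
  assumes c: "x \<in> carrier G" "y \<in> carrier G" "w \<in> carrier G"
    and n: "commutator x y \<noteq> \<one>" "commutator y w \<noteq> \<one>"
  shows "commutator x y = commutator y w"
proof (rule ccontr)
  assume ne: "commutator x y \<noteq> commutator y w"
  \<comment> \<open>Replacing \<open>x\<close> by \<open>x y\<close> or \<open>w\<close> by \<open>w y\<close> keeps the two given commutators but changes the third,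
    so all of \<open>c\<close>, \<open>c a\<close>, \<open>c b\<close>, \<open>c a b\<close> would lie in a set of three elements.\<close>
  let ?a = "commutator x y" and ?b = "commutator y w" and ?c = "commutator x w"
  have xy: "commutator (x \<otimes> y) y = ?a" and yw: "commutator y (w \<otimes> y) = ?b"
    using c by (simp_all add: commutator_mult_left commutator_mult_right commutator_self)
  have "?c \<in> {\<one>, ?a, ?b}" using commutator_triple[OF c n ne] .
  moreover have "?c \<otimes> ?b \<in> {\<one>, ?a, ?b}"
    using commutator_triple[of "x \<otimes> y" y w] c n ne by (simp add: xy) (simp add: commutator_mult_left)
  moreover have "?c \<otimes> ?a \<in> {\<one>, ?a, ?b}"
    using commutator_triple[of x y "w \<otimes> y"] c n ne by (simp add: yw) (simp add: commutator_mult_right)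
  moreover have "commutator (x \<otimes> y) (w \<otimes> y) \<in> {\<one>, ?a, ?b}"
    using commutator_triple[of "x \<otimes> y" y "w \<otimes> y"] c n ne by (simp add: xy yw)
  then have "?c \<otimes> ?a \<otimes> ?b \<in> {\<one>, ?a, ?b}"
    using c by (simp add: yw commutator_mult_left) (simp add: commutator_mult_right)
  moreover have "?a \<otimes> ?b \<notin> {\<one>, ?a, ?b}"
  proof -
    have "?a \<otimes> ?b \<noteq> \<one>"
      using ne c by (metis commutator_closed commutator_square inv_equality)
    moreover have "?a \<otimes> ?b \<noteq> ?a" "?a \<otimes> ?b \<noteq> ?b" using n c by simp_all
    ultimately show ?thesis by blast
  qed
  moreover have "?b \<otimes> ?a = ?a \<otimes> ?b" using c by (intro commutator_central) simp_all
  moreover have "\<one> \<otimes> ?a \<otimes> ?b = ?a \<otimes> ?b" using c by simp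
  \<comment> \<open>Each of \<open>?c = \<one>\<close>, \<open>?c = ?a\<close> and
    \<open>?c = ?b\<close> puts \<open>?a \<otimes> ?b\<close> into the three-element set.\<close>
  ultimately show False by (metis insertE singletonD)
qed

text \<open>A nontrivial commutator between the two pairs links them through adjacent commutators.
  If the three tested ones are trivial, \<open>a \<otimes> x\<close> serves as a common middle
  element, by bilinearity.\<close>

lemma commutator_unique_nontrivial:
  assumes c: "a \<in> carrier G" "b \<in> carrier G" "x \<in> carrier G" "y \<in> carrier G"
    and n: "commutator a b \<noteq> \<one>" "commutator x y \<noteq> \<one>"
  shows "commutator a b = commutator x y"
proof -
  have adj: "commutator a b = commutator x y"
    if "a \<in> carrier G" "b \<in> carrier G" "x \<in> carrier G" "y \<in> carrier G"
      "commutator a b \<noteq> \<one>" "commutator x y \<noteq> \<one>" "commutator b x \<noteq> \<one>" for a b x y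
    using commutator_adjacent[of a b x] commutator_adjacent[of b x y] that by simp
  consider "commutator b x \<noteq> \<one>" | "commutator a x \<noteq> \<one>" | "commutator a y \<noteq> \<one>"
    | "commutator b x = \<one>" "commutator a x = \<one>" "commutator a y = \<one>"
    by blast
  then show ?thesis
  proof cases
    case 1
    then show ?thesis using adj c n by blast
  next
    case 2
    then show ?thesis using adj[of b a x y] c n by (simp add: commutator_swap[of a b])
  next
    case 3
    then show ?thesis using adj[of b a y x] c n by (simp add: commutator_swap[of a b] commutator_swap[of x y])
  next
    case 4
    have "commutator b (a \<otimes> x) = commutator a b" "commutator (a \<otimes> x) y = commutator x y"
      using 4 c by (simp_all add: commutator_mult_left commutator_mult_right commutator_swap[of a b])
    then show ?thesis using commutator_adjacent[of b "a \<otimes> x" y] c n by simp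
  qed
qed

lemma card_derived_le_2: "card (derived G (carrier G)) \<le> 2"
proof (cases "\<exists>a \<in> carrier G. \<exists>b \<in> carrier G. commutator a b \<noteq> \<one>")
  case True
  then obtain a b where ab: "a \<in> carrier G" "b \<in> carrier G" "commutator a b \<noteq> \<one>" by blast
  have "commutator x y \<in> {\<one>, commutator a b}" if "x \<in> carrier G" "y \<in> carrier G" for x y
    using commutator_unique_nontrivial[OF ab(1,2) that ab(3)]
    by (cases "commutator x y = \<one>") simp_all
  then show ?thesis
    unfolding card_derived_le_2_iff[OF finite_carrier]
    by (intro bexI[OF _ commutator_closed[OF ab(1,2)]] conjI ballI
        commutator_square[OF ab(1,2)] commutator_central[OF ab(1,2)])
next
  case False
  then show ?thesis
    unfolding card_derived_le_2_iff[OF finite_carrier] by (intro bexI[of _ \<one>]) auto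
qed

end

section \<open>The class semigroup of product-one sequences\<close>

context group
begin

lemma clifford_imp_seminormal:
  assumes cl: "clifford_semigroup (class_semigroup (product_one_seqs G) (free_comm_monoid (carrier G)))"
    and fin: "finite (carrier G)"
  shows "seminormal_monoid (product_one_monoid G)"
  unfolding seminormal_product_one_iff
proof (intro allI impI)
  let ?B = "product_one_seqs G" and ?F = "free_comm_monoid (carrier G)"
  let ?C = "class_semigroup ?B ?F" and ?cl = "cong_class ?B ?F"
  interpret F: comm_monoid ?F by (rule comm_monoid_free_comm_monoid)
  interpret C: comm_monoid ?C by (rule F.comm_monoid_class_semigroup)
  fix S A
  assume "A \<in> ?B" "S + A \<in> ?B" and S2: "repeat_mset 2 S \<in> ?B" and S3: "repeat_mset 3 S \<in> ?B"
  have S: "set_mset S \<subseteq> carrier G" using product_one_subset[OF \<open>S + A \<in> ?B\<close>] by simp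
  have car: "carrier ?C = ?cl ` carrier ?F" by (simp add: class_semigroup_def)
  then have "?cl S \<in> carrier ?C" using S by simp
  then obtain K e where K: "?cl S \<in> K" "K \<subseteq> carrier ?C" "group (?C\<lparr>carrier := K, one := e\<rparr>)"
    using cl unfolding clifford_semigroup_def by blast
  interpret K: group "?C\<lparr>carrier := K, one := e\<rparr>" by (rule K)
  \<comment> \<open>The inverse of the class of \<open>S\<close> in its subgroup is represented by
    \<open>T\<close>, so \<open>S\<close> and \<open>T + S + S\<close> are congruent.\<close>
  obtain Y where Y: "Y \<in> K" "Y \<otimes>\<^bsub>?C\<^esub> ?cl S = e" using K.l_inv_ex[of "?cl S"] K(1) by auto
  then obtain T where T: "Y = ?cl T" "set_mset T \<subseteq> carrier G" using K(2) car by auto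
  have "?cl S = ?cl T \<otimes>\<^bsub>?C\<^esub> ?cl S \<otimes>\<^bsub>?C\<^esub> ?cl S"
    using K.l_one[of "?cl S"] K(1) Y T by simp
  also have "\<dots> = ?cl (T + S + S)"
    using S T F.class_semigroup_mult[of T S] F.class_semigroup_mult[of "T + S" S] by simp
  finally have eq: "S + Z \<in> ?B \<longleftrightarrow> (T + S) + (S + Z) \<in> ?B" if "set_mset Z \<subseteq> carrier G" for Z
    using that S T F.cong_class_eq_iff[of S "T + S + S"] by (simp add: add.assoc)
  have absorb: "S \<in> ?B \<longleftrightarrow> repeat_mset n (T + S) + S \<in> ?B" for n
  proof (induction n)
    case (Suc n)
    have "S + repeat_mset n (T + S) \<in> ?B \<longleftrightarrow> (T + S) + (S + repeat_mset n (T + S)) \<in> ?B"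
      using S T by (intro eq repeat_mset_subset) auto
    then show ?case using Suc by (simp add: ac_simps)
  qed simp
  \<comment> \<open>Every \<open>n \<ge> 2\<close> has the form \<open>2 * i\<close> or
    \<open>2 * i + 3\<close>.\<close>
  have multiple: "repeat_mset n S \<in> ?B" if n: "n \<ge> 2" for n
  proof (cases "even n")
    case True
    then obtain i where "n = i * 2" by (metis dvd_div_mult_self)
    then show ?thesis using product_one_repeat[OF S2, of i] by simp
  next
    case False
    then have "\<exists>i. n = i * 2 + 3" using n by presburger
    then obtain i where "n = i * 2 + 3" ..
    then show ?thesis using product_one_add[OF product_one_repeat[OF S2, of i] S3]
      by (simp only: repeat_mset_distrib repeat_mset_right)
  qed
  have "order G > 0" using fin order_gt_0_iff_finite by blast
  then have "repeat_mset (Suc (order G)) S \<in> ?B" by (intro multiple) simp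
  then have "repeat_mset (order G) T + repeat_mset (Suc (order G)) S \<in> ?B"
    by (rule product_one_add[OF product_one_repeat_order[OF T(2)]])
  then show "S \<in> ?B" using absorb[of "order G"] by (simp add: ac_simps)
qed

text \<open>Idempotence makes \<open>S\<close> congruent to all its positive multiples, and the
  \<open>order G\<close>-fold one is product-one.\<close>

lemma product_one_if_idempotent:
  assumes S: "set_mset S \<subseteq> carrier G"
    and idem: "cong_class (product_one_seqs G) (free_comm_monoid (carrier G)) S
      \<in> idempotents (class_semigroup (product_one_seqs G) (free_comm_monoid (carrier G)))"
    and fin: "finite (carrier G)"
  shows "S \<in> product_one_seqs G"
proof -
  let ?B = "product_one_seqs G" and ?F = "free_comm_monoid (carrier G)"
  interpret F: comm_monoid ?F by (rule comm_monoid_free_comm_monoid)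
  have "cong_class ?B ?F (S + S) = cong_class ?B ?F S"
    using idem S F.class_semigroup_mult[of S S] by (simp add: idempotents_def)
  then have eq: "S + S + Z \<in> ?B \<longleftrightarrow> S + Z \<in> ?B" if "set_mset Z \<subseteq> carrier G" for Z
    using that S F.cong_class_eq_iff[of "S + S" S] by simp
  have "repeat_mset (Suc n) S \<in> ?B \<longleftrightarrow> S \<in> ?B" for n
  proof (induction n)
    case (Suc n)
    have "S + S + repeat_mset n S \<in> ?B \<longleftrightarrow> S + repeat_mset n S \<in> ?B"
      using S by (intro eq repeat_mset_subset)
    then show ?case using Suc by (simp add: add.assoc)
  qed simp
  moreover have "order G > 0" using fin order_gt_0_iff_finite by blast
  ultimately show ?thesis using product_one_repeat_order[OF S] by (metis gr0_implies_Suc)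
qed

end

context central_commutators
begin

lemma idempotent_if_product_one:
  assumes "S \<in> product_one_seqs G"
  shows "cong_class (product_one_seqs G) (free_comm_monoid (carrier G)) S
    \<in> idempotents (class_semigroup (product_one_seqs G) (free_comm_monoid (carrier G)))"
proof -
  let ?B = "product_one_seqs G" and ?F = "free_comm_monoid (carrier G)"
  interpret F: comm_monoid ?F by (rule comm_monoid_free_comm_monoid)
  obtain xs where xs: "S = mset xs" "set xs \<subseteq> carrier G" "lprod xs = \<one>"
    using assms by (metis product_one_seqsE)
  then have "cong_class ?B ?F (mset (xs @ xs)) = cong_class ?B ?F (mset xs)"
    by (intro cong_class_eqI) (auto simp: lprod_append)
  then show ?thesis
    using xs F.class_semigroup_mult[of S S ?B]
    by (simp add: idempotents_def) (simp add: class_semigroup_def)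
qed

lemma clifford_class_semigroup:
  assumes fin: "finite (carrier G)"
  shows "clifford_semigroup (class_semigroup (product_one_seqs G) (free_comm_monoid (carrier G)))"
  unfolding clifford_semigroup_def
proof
  let ?B = "product_one_seqs G" and ?F = "free_comm_monoid (carrier G)"
  let ?C = "class_semigroup ?B ?F" and ?cl = "cong_class ?B ?F"
  interpret F: comm_monoid ?F by (rule comm_monoid_free_comm_monoid)
  interpret C: comm_monoid ?C by (rule F.comm_monoid_class_semigroup)
  fix X assume X: "X \<in> carrier ?C"
  then obtain S where S: "X = ?cl S" "set_mset S \<subseteq> carrier G"
    by (auto simp: class_semigroup_def)
  obtain xs where xs: "mset xs = S" using ex_mset by blast
  then have c: "set xs \<subseteq> carrier G" using S by auto
  have pow: "X [^]\<^bsub>?C\<^esub> n = ?cl (repeat_mset n S)" for n :: nat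
  proof (induction n)
    case 0
    then show ?case by (simp add: class_semigroup_def)
  next
    case (Suc n)
    then show ?case
      using S F.class_semigroup_mult[of "repeat_mset n S" S ?B] repeat_mset_subset[of S "carrier G" n]
      by (simp add: add.commute)
  qed
  have m: "order G > 0" using fin order_gt_0_iff_finite by blast
  \<comment> \<open>Since \<open>order G\<close> kills every element, \<open>Suc (order G)\<close>
    copies of \<open>xs\<close> have the same product and support as \<open>xs\<close>.\<close>
  have "?cl (mset (concat (replicate (Suc (order G)) xs))) = ?cl (mset xs)"
    using c pow_order_eq_1[of "lprod xs"]
    by (intro cong_class_eqI) (auto simp: lprod_concat_replicate simp del: replicate_Suc)
  then have "?cl (repeat_mset (Suc (order G)) S) = X"
    unfolding mset_concat_replicate xs S(1) .
  with pow have "X [^]\<^bsub>?C\<^esub> Suc (order G) = X" by (rule trans)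
  then have "group (?C\<lparr>carrier := {X [^]\<^bsub>?C\<^esub> k | k. k > (0::nat)}, one := X [^]\<^bsub>?C\<^esub> order G\<rparr>)"
    using C.group_of_powers X m by blast
  moreover have "X \<in> {X [^]\<^bsub>?C\<^esub> k | k. k > (0::nat)}"
    using X C.nat_pow_eone[of X] by (metis (mono_tags, lifting) mem_Collect_eq zero_less_one)
  moreover have "{X [^]\<^bsub>?C\<^esub> k | k. k > (0::nat)} \<subseteq> carrier ?C"
    using X by auto
  ultimately show "\<exists>K e. X \<in> K \<and> K \<subseteq> carrier ?C \<and> group (?C\<lparr>carrier := K, one := e\<rparr>)"
    by (intro exI conjI)
qed

end

theorem corollary3p12:
  fixes G :: "('a, 'b) monoid_scheme"
  assumes "group G" and "finite (carrier G)"
  shows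
    "let F = free_comm_monoid (carrier G);
         B = product_one_seqs G;
         C = class_semigroup B F
     in (card (derived G (carrier G)) \<le> 2 \<longleftrightarrow> seminormal_monoid (product_one_monoid G)) \<and>
        (seminormal_monoid (product_one_monoid G) \<longleftrightarrow> clifford_semigroup C) \<and>
        (card (derived G (carrier G)) \<le> 2 \<longrightarrow>
          B = {S \<in> carrier F. cong_class B F S \<in> idempotents C})"
proof -
  interpret group G by (rule assms(1))
  let ?B = "product_one_seqs G" and ?F = "free_comm_monoid (carrier G)"
  let ?C = "class_semigroup ?B ?F"
  \<comment> \<open>The equivalences close up as the cycle (b) to (a), (a) to (c), (c) to
    (b).\<close>
  have ab: "card (derived G (carrier G)) \<le> 2" if "seminormal_monoid (product_one_monoid G)"
  proof -
    interpret seminormal_product_one_group G by unfold_locales (use assms(2) that in auto)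
    show ?thesis by (rule card_derived_le_2)
  qed
  have locz: "\<exists>z. central_commutators G z" if "card (derived G (carrier G)) \<le> 2"
    using that unfolding card_derived_le_2_iff[OF assms(2)]
    by (auto simp: central_commutators_def central_commutators_axioms_def assms(1))
  have ac: "clifford_semigroup ?C" if "card (derived G (carrier G)) \<le> 2"
    using locz[OF that] central_commutators.clifford_class_semigroup[OF _ assms(2)] by (elim exE)
  have cb: "seminormal_monoid (product_one_monoid G)" if "clifford_semigroup ?C"
    by (rule clifford_imp_seminormal[OF that assms(2)])
  have "?B = {S \<in> carrier ?F. cong_class ?B ?F S \<in> idempotents ?C}" if "card (derived G (carrier G)) \<le> 2"
  proof (intro Set.set_eqI iffI CollectI conjI)
    fix S assume S: "S \<in> ?B"
    show "S \<in> carrier ?F" using product_one_subset[OF S] by simp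
    show "cong_class ?B ?F S \<in> idempotents ?C"
      using locz[OF that] central_commutators.idempotent_if_product_one[OF _ S] by (elim exE)
  next
    fix S assume "S \<in> {S \<in> carrier ?F. cong_class ?B ?F S \<in> idempotents ?C}"
    then show "S \<in> ?B" by (intro product_one_if_idempotent assms(2)) auto
  qed
  then show ?thesis unfolding Let_def using ab ac cb by (intro conjI iffI impI) simp_all
qed

end
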